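(* Let $q\ge 2$ and $d\ge1$ be integers. On the infinite $(q+1)$-regular tree $\mathbb{T}_{q+1}$, let $X,Y$ be vertices with $\operatorname{dist}(X,Y)=d$ and let $\sigma_X^n,\sigma_Y^n$ be the uniform probability measures on the spheres of radius $n$ centered at $X$ and $Y$. Put $\delta=\lfloor d/2\rfloor$, $\delta'=\lceil d/2\rceil$. Then, as $n\to\infty$, \[ W_1(\sigma_X^n, \sigma_Y^n) = A^{\mathrm{sphere}}_{d, q} \cdot n + B^{\mathrm{sphere}}_{d, q} + o(1), \] where \[ A^{\mathrm{sphere}}_{d,q} = \frac{2(q+1-q^{1-\delta'} - q^{-\delta})}{q+1},\qquad B^{\mathrm{sphere}}_{d,q} = d + \frac{-4q+2(\delta'(q-1)+1)q^{1-\delta'} + 2(\delta(q-1)+q) q^{-\delta}}{q^2-1}. \]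
   Context: The sphere of radius $r$ centered at $u$ is $\{v:\operatorname{dist}(u,v)=r\}$ (it has $(q+1)q^{r-1}$ vertices for $r\ge1$ and $1$ vertex for $r=0$); $\sigma_u^r$ assigns equal mass to each of its vertices and $0$ elsewhere. $W_1$ is the $1$-Wasserstein distance with respect to graph distance: the minimum over couplings $\pi$ of $\mu,\nu$ of $\sum_{v,w}\operatorname{dist}(v,w)\pi(v,w)$. *)

theory Defs
  imports
    "HOL-Probability.Probability_Mass_Function"
    "HOL-Analysis.Function_Topology"
    "Graph_Theory.Digraph_Component"
begin

(* An undirected simple graph is a loop-free symmetric digraph, so each edge {u,v} is the pair of
   arcs (u,v), (v,u). The library predicate forest counts u,v,u as a cycle and so does not describe
   undirected acyclicity: an undirected cycle is a directed cycle of length at least 3.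
   Connectedness includes non-emptiness, and for k >= 2 such a graph is infinite. *)
definition regular_tree :: "nat \<Rightarrow> 'a pair_pre_digraph \<Rightarrow> bool" where
  "regular_tree k G \<longleftrightarrow>
     pair_bidirected_digraph G \<and>
     Digraph_Component.connected (with_proj G) \<and>
     \<not> (\<exists>p. pre_digraph.cycle (with_proj G) p \<and> length p \<ge> 3) \<and>
     (\<forall>v\<in>pverts G. out_degree (with_proj G) v = k)"

definition gdist :: "'a pair_pre_digraph \<Rightarrow> 'a \<Rightarrow> 'a \<Rightarrow> nat" where
  "gdist G u v = (LEAST n. \<exists>p. pre_digraph.awalk (with_proj G) u p v \<and> length p = n)"

definition gsphere :: "'a pair_pre_digraph \<Rightarrow> 'a \<Rightarrow> nat \<Rightarrow> 'a set" where
  "gsphere G u r = {v \<in> pverts G. gdist G u v = r}"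

definition sphere_measure :: "'a pair_pre_digraph \<Rightarrow> 'a \<Rightarrow> nat \<Rightarrow> 'a pmf" where
  "sphere_measure G u r = pmf_of_set (gsphere G u r)"

definition couplings :: "'a pmf \<Rightarrow> 'b pmf \<Rightarrow> ('a \<times> 'b) pmf set" where
  "couplings \<mu> \<nu> = {\<pi>. map_pmf fst \<pi> = \<mu> \<and> map_pmf snd \<pi> = \<nu>}"

definition transport_cost :: "'a pair_pre_digraph \<Rightarrow> ('a \<times> 'a) pmf \<Rightarrow> real" where
  "transport_cost G \<pi> = measure_pmf.expectation \<pi> (\<lambda>(v, w). real (gdist G v w))"

(* Couplings of infinite cost are excluded because the Bochner integral would give them cost 0.
   If both supports are finite, all couplings qualify and the infimum is a minimum
   (lemma W1_minimum). *)
definition W1 :: "'a pair_pre_digraph \<Rightarrow> 'a pmf \<Rightarrow> 'a pmf \<Rightarrow> real" where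
  "W1 G \<mu> \<nu> = Inf (transport_cost G ` {\<pi> \<in> couplings \<mu> \<nu>.
     integrable (measure_pmf \<pi>) (\<lambda>(v, w). real (gdist G v w))})"

definition A_sphere :: "nat \<Rightarrow> nat \<Rightarrow> real" where
  "A_sphere d q =
     (let \<delta> = \<lfloor>real d / 2\<rfloor>; \<delta>' = \<lceil>real d / 2\<rceil> in
      2 * (real q + 1 - real q powi (1 - \<delta>') - real q powi (- \<delta>)) / (real q + 1))"

definition B_sphere :: "nat \<Rightarrow> nat \<Rightarrow> real" where
  "B_sphere d q =
     (let \<delta> = \<lfloor>real d / 2\<rfloor>; \<delta>' = \<lceil>real d / 2\<rceil> in
      real d + (- 4 * real q
                + 2 * (of_int \<delta>' * (real q - 1) + 1) * real q powi (1 - \<delta>')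
                + 2 * (of_int \<delta> * (real q - 1) + real q) * real q powi (- \<delta>))
               / ((real q)\<^sup>2 - 1))"

lemma couplings_subset:
  assumes "\<pi> \<in> couplings \<mu> \<nu>"
  shows "set_pmf \<pi> \<subseteq> set_pmf \<mu> \<times> set_pmf \<nu>"
proof
  fix x assume x: "x \<in> set_pmf \<pi>"
  have "fst x \<in> set_pmf (map_pmf fst \<pi>)" "snd x \<in> set_pmf (map_pmf snd \<pi>)"
    using x by auto
  then have "fst x \<in> set_pmf \<mu>" "snd x \<in> set_pmf \<nu>"
    using assms unfolding couplings_def mem_Collect_eq by metis+
  then show "x \<in> set_pmf \<mu> \<times> set_pmf \<nu>"
    by (cases x) simp
qed

lemma pmf_map_fst_sum:
  assumes "finite B" "set_pmf \<pi> \<subseteq> A \<times> B"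
  shows "pmf (map_pmf fst \<pi>) a = (\<Sum>b\<in>B. pmf \<pi> (a, b))"
proof -
  have "pmf (map_pmf fst \<pi>) a = measure (measure_pmf \<pi>) (fst -` {a})"
    by (simp add: pmf_map)
  also have "\<dots> = measure (measure_pmf \<pi>) ((\<lambda>b. (a, b)) ` B)"
    using assms(2) by (intro measure_pmf.finite_measure_eq_AE) (auto simp: AE_measure_pmf_iff)
  also have "\<dots> = (\<Sum>x\<in>(\<lambda>b. (a, b)) ` B. pmf \<pi> x)"
    using assms(1) by (intro measure_measure_pmf_finite) auto
  also have "\<dots> = (\<Sum>b\<in>B. pmf \<pi> (a, b))"
    by (subst sum.reindex) (auto simp: inj_on_def)
  finally show ?thesis .
qed

lemma pmf_map_snd_sum:
  assumes "finite A" "set_pmf \<pi> \<subseteq> A \<times> B"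
  shows "pmf (map_pmf snd \<pi>) b = (\<Sum>a\<in>A. pmf \<pi> (a, b))"
proof -
  have "pmf (map_pmf snd \<pi>) b = measure (measure_pmf \<pi>) (snd -` {b})"
    by (simp add: pmf_map)
  also have "\<dots> = measure (measure_pmf \<pi>) ((\<lambda>a. (a, b)) ` A)"
    using assms(2) by (intro measure_pmf.finite_measure_eq_AE) (auto simp: AE_measure_pmf_iff)
  also have "\<dots> = (\<Sum>x\<in>(\<lambda>a. (a, b)) ` A. pmf \<pi> x)"
    using assms(1) by (intro measure_measure_pmf_finite) auto
  also have "\<dots> = (\<Sum>a\<in>A. pmf \<pi> (a, b))"
    by (subst sum.reindex) (auto simp: inj_on_def)
  finally show ?thesis .
qed

lemma W1_minimum:
  assumes fin: "finite (set_pmf \<mu>)" "finite (set_pmf \<nu>)"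
  shows "\<exists>\<pi>\<in>couplings \<mu> \<nu>. W1 G \<mu> \<nu> = transport_cost G \<pi> \<and>
           (\<forall>\<pi>'\<in>couplings \<mu> \<nu>. transport_cost G \<pi> \<le> transport_cost G \<pi>')"
proof -
  define A B where "A = set_pmf \<mu>" and "B = set_pmf \<nu>"
  define S where "S = A \<times> B"
  have finS: "finite S" "finite A" "finite B" using fin by (auto simp: S_def A_def B_def)
  define c where "c = (\<lambda>f::_ \<Rightarrow> real. \<Sum>x\<in>S. f x * (case x of (v, w) \<Rightarrow> real (gdist G v w)))"
  define K where "K = (\<Pi>\<^sub>E x\<in>UNIV. if x \<in> S then {0..1::real} else {0})
     \<inter> ((\<Inter>a\<in>A. {f. (\<Sum>b\<in>B. f (a, b)) = pmf \<mu> a}) \<inter> (\<Inter>b\<in>B. {f. (\<Sum>a\<in>A. f (a, b)) = pmf \<nu> b}))"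
  have contp: "continuous_on UNIV (\<lambda>f::_ \<Rightarrow> real. f x)" for x :: "'a \<times> 'a"
    by (rule continuous_on_product_coordinates)
  have "compact (\<Pi>\<^sub>E x\<in>UNIV. if x \<in> S then {0..1::real} else {0})"
    unfolding compactin_euclidean_iff[symmetric] euclidean_product_topology[symmetric] compactin_PiE
    by auto
  moreover have "closed {f. (\<Sum>b\<in>B. f (a, b)) = pmf \<mu> a}"
    for a by (intro closed_Collect_eq continuous_on_sum contp continuous_on_const)
  moreover have "closed {f. (\<Sum>a\<in>A. f (a, b)) = pmf \<nu> b}"
    for b by (intro closed_Collect_eq continuous_on_sum contp continuous_on_const)
  ultimately have compK: "compact K"
    unfolding K_def by (intro compact_Int_closed closed_Int closed_INT) auto
  have contc: "continuous_on K c"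
    unfolding c_def
    by (intro continuous_on_sum continuous_on_mult continuous_on_const
          continuous_on_subset[OF contp]) auto
  have sub: "set_pmf \<pi> \<subseteq> S" if "\<pi> \<in> couplings \<mu> \<nu>" for \<pi>
    using couplings_subset[OF that] by (simp add: S_def A_def B_def)
  have inK: "pmf \<pi> \<in> K" if "\<pi> \<in> couplings \<mu> \<nu>" for \<pi>
  proof -
    have m: "map_pmf fst \<pi> = \<mu>" "map_pmf snd \<pi> = \<nu>" using that by (auto simp: couplings_def)
    have s: "set_pmf \<pi> \<subseteq> A \<times> B" using sub[OF that] by (simp add: S_def)
    have "pmf \<pi> x = 0" if "x \<notin> S" for x
      using sub[OF \<open>\<pi> \<in> _\<close>] that by (auto simp: set_pmf_iff)
    then show ?thesis
      using pmf_map_fst_sum[OF finS(3) s] pmf_map_snd_sum[OF finS(2) s] m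
      by (auto simp: K_def pmf_le_1)
  qed
  have cost: "transport_cost G \<pi> = c (pmf \<pi>)" if "\<pi> \<in> couplings \<mu> \<nu>" for \<pi>
    unfolding transport_cost_def c_def
    using sub[OF that] finS(1)
    by (subst integral_measure_pmf_real[of S]) (auto simp: mult.commute)
  have integ: "integrable (measure_pmf \<pi>) (\<lambda>(v, w). real (gdist G v w))"
    if "\<pi> \<in> couplings \<mu> \<nu>" for \<pi>
    using sub[OF that] finS(1) by (intro integrable_measure_pmf_finite) (rule finite_subset)
  have "pair_pmf \<mu> \<nu> \<in> couplings \<mu> \<nu>"
    by (simp add: couplings_def map_fst_pair_pmf map_snd_pair_pmf)
  then have "K \<noteq> {}" using inK by blast
  then obtain f where f: "f \<in> K" "\<And>g. g \<in> K \<Longrightarrow> c f \<le> c g"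
    using continuous_attains_inf[OF compK _ contc] by blast
  have fx: "f x \<in> (if x \<in> S then {0..1} else {0})" for x
    using f(1) unfolding K_def by (blast dest: PiE_mem)
  have fS: "f x = 0" if "x \<notin> S" for x
    using fx[of x] that by simp
  have f0: "0 \<le> f x" for x
    using fx[of x] by (cases "x \<in> S") auto
  have fA: "(\<Sum>b\<in>B. f (a, b)) = pmf \<mu> a" for a
  proof (cases "a \<in> A")
    case False
    then show ?thesis using fS by (auto simp: S_def A_def set_pmf_iff intro!: sum.neutral)
  qed (use f(1) in \<open>auto simp: K_def\<close>)
  have fB: "(\<Sum>a\<in>A. f (a, b)) = pmf \<nu> b" for b
  proof (cases "b \<in> B")
    case False
    then show ?thesis using fS by (auto simp: S_def B_def set_pmf_iff intro!: sum.neutral)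
  qed (use f(1) in \<open>auto simp: K_def\<close>)
  have "(\<Sum>x\<in>S. f x) = (\<Sum>a\<in>A. \<Sum>b\<in>B. f (a, b))"
    unfolding S_def by (simp add: sum.cartesian_product)
  also have "\<dots> = 1" using fA sum_pmf_eq_1[OF finS(2), of \<mu>] by (simp add: A_def)
  finally have sum1: "(\<Sum>x\<in>S. f x) = 1" .
  have "(\<integral>\<^sup>+ x. ennreal (f x) \<partial>count_space UNIV) = (\<Sum>x\<in>S. ennreal (f x))"
    using finS(1) fS by (intro nn_integral_count_space'[of S]) auto
  also have "\<dots> = 1" using sum1 f0 by (simp add: sum_ennreal)
  finally have tot: "(\<integral>\<^sup>+ x. ennreal (f x) \<partial>count_space UNIV) = 1" .
  define \<pi> where "\<pi> = embed_pmf f"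
  have pf: "pmf \<pi> = f" using pmf_embed_pmf[OF f0 tot] by (auto simp: \<pi>_def)
  have s: "set_pmf \<pi> \<subseteq> A \<times> B" using fS unfolding S_def set_pmf_iff pf set_pmf_eq by blast
  have pc: "\<pi> \<in> couplings \<mu> \<nu>"
    unfolding couplings_def
    using pmf_map_fst_sum[OF finS(3) s] pmf_map_snd_sum[OF finS(2) s] fA fB
    by (auto simp: pf intro!: pmf_eqI)
  have min: "transport_cost G \<pi> \<le> transport_cost G \<pi>'" if "\<pi>' \<in> couplings \<mu> \<nu>" for \<pi>'
    using f(2)[OF inK[OF that]] by (simp add: cost that pc pf)
  have "W1 G \<mu> \<nu> = transport_cost G \<pi>"
    unfolding W1_def by (rule cInf_eq_minimum) (use pc integ min in auto)
  with pc min show ?thesis by blast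
qed

end

theory Submission
  imports Defs
begin

text \<open>
  The four point condition of trees makes the following function \<open>f\<close> 1-Lipschitz: \<open>f v = dist Y v - d/2\<close>
  if \<open>v\<close> is nearer to \<open>X\<close>, \<open>f v = d/2 - dist X v\<close> if \<open>v\<close> is nearer to \<open>Y\<close>, and \<open>f v = 0\<close> otherwise.
  There is a bijection \<open>\<phi>\<close> from the sphere around \<open>X\<close> to the sphere around \<open>Y\<close> with
  \<open>dist v (\<phi> v) = f v - f (\<phi> v)\<close>: a vertex \<open>w\<close> of the target sphere nearer to \<open>X\<close> is matched with some
  vertex \<open>v\<close> of the source sphere such that \<open>w\<close> lies on the geodesic from \<open>v\<close> to \<open>Y\<close>, symmetrically
  for the source vertices nearer to \<open>Y\<close>, common vertices stay fixed, and the vertices left over lie on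
  opposite sides, where every matching is tight by the four point condition. Hence \<open>\<phi>\<close> is an optimal
  transport map, \<open>W1\<close> is the difference of the mean values of \<open>f\<close> on the two spheres, and counting the
  vertices over each point of the geodesic shows that the asymptotic formula is exact for \<open>n > d\<close>.
\<close>

section \<open>The metric of a tree\<close>

locale tree_graph = pair_bidirected_digraph G for G :: "'a pair_pre_digraph" +
  assumes conn: "Digraph_Component.connected (with_proj G)"
    and no_cycle: "pre_digraph.cycle (with_proj G) p \<Longrightarrow> length p < 3"
begin

abbreviation V where "V \<equiv> pverts G"
abbreviation D where "D \<equiv> gdist G"
abbreviation E where "E \<equiv> parcs G"

lemma adj_sym: "(u, v) \<in> E \<Longrightarrow> (v, u) \<in> E"
  by (rule arcs_symmetric)

lemma ex_awalk:
  assumes "u \<in> V" "v \<in> V"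
  shows "\<exists>p. awalk u p v"
proof -
  \<comment> \<open>Connectedness is defined through the symmetric closure, which adds no arcs to a
    bidirected graph.\<close>
  have "parcs (mk_symmetric (with_proj G)) = E"
    by (auto simp: mk_symmetric_def intro: adj_sym)
  then have "mk_symmetric (with_proj G) = G"
    by (simp add: mk_symmetric_def)
  then have "u \<rightarrow>\<^sup>*\<^bsub>with_proj G\<^esub> v"
    using conn assms by (auto simp: Digraph_Component.connected_def strongly_connected_def)
  then show ?thesis by (simp add: reachable_awalk)
qed

lemma geodesic_awalk:
  assumes "u \<in> V" "v \<in> V"
  shows "\<exists>p. awalk u p v \<and> length p = D u v"
proof -
  obtain p where "awalk u p v" using ex_awalk[OF assms] ..
  then show ?thesis
    unfolding gdist_def
    by (intro LeastI[of "\<lambda>n. \<exists>p. awalk u p v \<and> length p = n" "length p"]) auto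
qed

lemma gdist_le_length: "awalk u p v \<Longrightarrow> D u v \<le> length p"
  unfolding gdist_def by (rule Least_le) auto

lemma gdist_self: "u \<in> V \<Longrightarrow> D u u = 0"
  using gdist_le_length[of u "[]" u] by (simp add: awalk_Nil_iff)

lemma gdist_eq_0_iff: "u \<in> V \<Longrightarrow> v \<in> V \<Longrightarrow> D u v = 0 \<longleftrightarrow> u = v"
  using geodesic_awalk[of u v] by (auto simp: gdist_self awalk_Nil_iff)

lemma gdist_triangle:
  assumes "u \<in> V" "v \<in> V" "w \<in> V"
  shows "D u w \<le> D u v + D v w"
proof -
  obtain p p' where "awalk u p v" "length p = D u v" "awalk v p' w" "length p' = D v w"
    using geodesic_awalk assms by meson
  then show ?thesis
    using gdist_le_length[of u "p @ p'" w] by auto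
qed

lemma length_rev_path: "length (rev_path p) = length p"
  by (induction p) auto

lemma gdist_sym: "D u v = D v u"
proof -
  have "(\<exists>p. awalk u p v \<and> length p = n) \<longleftrightarrow> (\<exists>p. awalk v p u \<and> length p = n)" for n
    by (metis awalk_rev_path length_rev_path)
  then show ?thesis unfolding gdist_def by simp
qed

lemma gdist_adj_le:
  assumes "(u, v) \<in> E"
  shows "D u v \<le> 1"
  using gdist_le_length[of u "[(u, v)]" v] assms
  by (auto simp: awalk_simps dest: wellformed')

lemma gdist_Suc_neighbor:
  assumes "x \<in> V" "v \<in> V" "D x v = Suc k"
  shows "\<exists>u\<in>V. (v, u) \<in> E \<and> D x u = k"
proof -
  obtain p where p: "awalk v p x" "length p = Suc k"
    using geodesic_awalk[OF assms(2,1)] assms(3) gdist_sym by metis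
  then obtain e p' where [simp]: "p = e # p'" by (cases p) auto
  obtain u where [simp]: "e = (v, u)" "(v, u) \<in> E" and p': "awalk u p' x"
    using p by (cases e) (auto simp: awalk_simps)
  have u: "u \<in> V" by (rule wellformed'(2)[of v]) simp
  have "D x u \<le> k" using gdist_le_length[OF p'] p gdist_sym by simp
  moreover have "D x v \<le> D x u + D u v" by (rule gdist_triangle) (use assms u in auto)
  moreover have "D u v \<le> 1" using gdist_adj_le[of u v] adj_sym[of v u] by simp
  ultimately show ?thesis using assms(3) u by (intro bexI[of _ u]) auto
qed

section \<open>Simple walks and the absence of cycles\<close>

fun vertex_walk :: "'a list \<Rightarrow> bool" where
  "vertex_walk [] \<longleftrightarrow> False"
| "vertex_walk [u] \<longleftrightarrow> u \<in> V"
| "vertex_walk (u # v # vs) \<longleftrightarrow> (u, v) \<in> E \<and> vertex_walk (v # vs)"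

lemma vertex_walk_snoc:
  "vertex_walk vs \<Longrightarrow> (last vs, u) \<in> E \<Longrightarrow> vertex_walk (vs @ [u])"
  by (induction vs rule: vertex_walk.induct) (auto dest: wellformed')

lemma vertex_walk_Cons:
  "vertex_walk vs \<Longrightarrow> (u, hd vs) \<in> E \<Longrightarrow> vertex_walk (u # vs)"
  by (cases vs) auto

text \<open>Vertex lists are easy to extend at both ends; this lemma carries them back to arc lists,
  for which cycles are defined.\<close>

lemma vertex_walk_awalk:
  "vertex_walk vs \<Longrightarrow> \<exists>p. awalk (hd vs) p (last vs) \<and> pawalk_verts (hd vs) p = vs"
proof (induction vs rule: vertex_walk.induct)
  case (2 u)
  then show ?case by (intro exI[of _ "[]"]) (auto simp: awalk_Nil_iff)
next
  case (3 u v vs)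
  then obtain p where "awalk v p (last (v # vs))" "pawalk_verts v p = v # vs" by auto
  with 3(2) show ?case
    by (intro exI[of _ "(u, v) # p"]) (simp add: awalk_Cons_iff)
qed auto

text \<open>The closed walk has one arc more than \<open>vs\<close> has entries, so the bound 2
  yields a cycle of length at least 3 and leaves out the walk back and forth along one edge.\<close>

lemma no_closed_vertex_walk:
  assumes "vertex_walk (t # vs @ [t])" "distinct (t # vs)" "length vs \<ge> 2"
  shows False
proof -
  obtain p where p: "awalk t p t" "pawalk_verts t p = t # vs @ [t]"
    using vertex_walk_awalk[OF assms(1)] by auto
  have l: "length p = Suc (length vs)"
    using length_awalk_verts[of t p] p(2) by simp
  have "cycle p"
    unfolding cycle_def using p assms l by (intro exI[of _ t]) auto
  with no_cycle[of p] l assms(3) show False by simp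
qed

text \<open>Extending both ends towards \<open>x\<close> by one vertex keeps the walk simple until the two
  extensions meet, which closes a cycle.\<close>

lemma no_walk_outside_ball:
  assumes "x \<in> V" "vertex_walk vs" "distinct vs" "length vs \<ge> 2"
    and "D x (hd vs) = k" "D x (last vs) = k" "\<And>w. w \<in> set vs \<Longrightarrow> w \<in> V \<and> k \<le> D x w"
  shows False
  using assms(2-)
proof (induction k arbitrary: vs)
  case 0
  then have ne: "vs \<noteq> []" by auto
  with 0 have "hd vs = x" "last vs = x"
    using assms(1) gdist_eq_0_iff by (metis hd_in_set, metis last_in_set)
  with 0(2,3) show ?case by (cases vs) (auto split: if_splits)
next
  case (Suc k)
  then have ne: "vs \<noteq> []" by auto
  then have V: "hd vs \<in> V" "last vs \<in> V" using Suc.prems(6) by auto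
  obtain t where t: "t \<in> V" "(hd vs, t) \<in> E" "D x t = k"
    using gdist_Suc_neighbor[OF assms(1) V(1) Suc.prems(4)] by blast
  obtain t' where t': "t' \<in> V" "(last vs, t') \<in> E" "D x t' = k"
    using gdist_Suc_neighbor[OF assms(1) V(2) Suc.prems(5)] by blast
  have walk: "vertex_walk (t # vs @ [t'])"
    using ne t t' adj_sym[OF t(2)] Suc.prems(1)
    by (intro vertex_walk_Cons vertex_walk_snoc) auto
  have new: "t \<notin> set vs" "t' \<notin> set vs" using t(3) t'(3) Suc.prems(6) by fastforce+
  show ?case
  proof (cases "t = t'")
    case True
    then show ?thesis
      using no_closed_vertex_walk[of t vs] walk new Suc.prems(2,3) by auto
  next
    case False
    show ?thesis
    proof (rule Suc.IH[of "t # vs @ [t']"])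
      fix w assume "w \<in> set (t # vs @ [t'])"
      then show "w \<in> V \<and> k \<le> D x w"
        using t(1,3) t'(1,3) Suc.prems(6)[of w] by auto
    qed (use walk new False Suc.prems(2,3) t(3) t'(3) in auto)
  qed
qed

text \<open>An edge inside one sphere around \<open>x\<close> would itself be a walk excluded by
  \<open>no_walk_outside_ball\<close>. This is bipartiteness, the source of the parity
  arguments.\<close>

lemma gdist_adj_neq:
  assumes "x \<in> V" "(u, v) \<in> E"
  shows "D x u \<noteq> D x v"
proof
  assume eq: "D x u = D x v"
  have V: "u \<in> V" "v \<in> V" using assms(2) wellformed' by blast+
  show False
  proof (rule no_walk_outside_ball[of x "[u, v]" "D x u"])
    fix w assume "w \<in> set [u, v]"
    then show "w \<in> V \<and> D x u \<le> D x w" using eq V by auto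
  qed (use eq assms V pair_no_loops[of "(u, v)"] in auto)
qed

lemma gdist_adj_cases:
  assumes "x \<in> V" "(u, v) \<in> E"
  obtains "D x v = Suc (D x u)" | "D x u = Suc (D x v)"
proof -
  have uv: "u \<in> V" "v \<in> V" using assms(2) wellformed' by blast+
  have "D x v \<le> D x u + D u v" "D x u \<le> D x v + D v u" "D u v \<le> 1" "D v u \<le> 1"
    using assms uv gdist_triangle[of x u v] gdist_triangle[of x v u] gdist_adj_le[of u v]
      gdist_adj_le[of v u] adj_sym[OF assms(2)] by auto
  with gdist_adj_neq[OF assms] have "D x v = Suc (D x u) \<or> D x u = Suc (D x v)" by linarith
  with that show ?thesis by blast
qed

text \<open>Two distinct parents of \<open>v\<close> would be the ends of a walk through
  \<open>v\<close> that never gets nearer to \<open>x\<close> than its ends.\<close>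

lemma closer_neighbor_unique:
  assumes "x \<in> V" "(v, u) \<in> E" "(v, u') \<in> E" "D x v = Suc (D x u)" "D x v = Suc (D x u')"
  shows "u = u'"
proof (rule ccontr)
  assume ne: "u \<noteq> u'"
  have V: "v \<in> V" "u \<in> V" "u' \<in> V" using assms(2,3) wellformed' by blast+
  show False
  proof (rule no_walk_outside_ball[of x "[u, v, u']" "D x u"])
    fix w assume "w \<in> set [u, v, u']"
    then show "w \<in> V \<and> D x u \<le> D x w" using assms(4,5) V by auto
  qed (use ne assms(1,3-5) V adj_sym[OF assms(2)] in auto)
qed

text \<open>A step towards \<open>x\<close> changes both distances by exactly one, so the parity is
  carried along to \<open>v = x\<close>.\<close>

lemma gdist_parity:
  assumes "x \<in> V" "y \<in> V" "v \<in> V"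
  shows "even (D x v + D y v + D x y)"
  using assms(3)
proof (induction "D x v" arbitrary: v)
  case 0
  then have "v = x" using assms(1) gdist_eq_0_iff by auto
  then show ?case using gdist_sym[of x y] assms(1) by (simp add: gdist_self)
next
  case (Suc k)
  then obtain u where u: "u \<in> V" "(v, u) \<in> E" "D x u = k"
    using gdist_Suc_neighbor[OF assms(1) Suc.prems, of k] by metis
  then have "even (D x u + D y u + D x y)" using Suc.hyps by auto
  moreover have "D x v = Suc (D x u)" using u Suc.hyps by simp
  moreover have "D y u = Suc (D y v) \<or> D y v = Suc (D y u)"
    using gdist_adj_cases[OF assms(2) u(2)] by metis
  ultimately show ?case by auto
qed

text \<open>Induction backwards from \<open>v\<close>: the first step towards \<open>u\<close> and
  the first step towards \<open>u'\<close> both approach \<open>x\<close>, and only one neighbour of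
  \<open>v\<close> does so.\<close>

lemma geodesic_point_unique:
  assumes "x \<in> V" "v \<in> V" "u \<in> V" "u' \<in> V" "D x u = D x u'" "D u v = D u' v"
    and "D x v = D x u + D u v"
  shows "u = u'"
  using assms(2,6,7)
proof (induction "D u v" arbitrary: v)
  case 0
  then show ?case using assms gdist_eq_0_iff by metis
next
  case (Suc m)
  obtain t where t: "t \<in> V" "(v, t) \<in> E" "D u t = m"
    using gdist_Suc_neighbor[OF assms(3) Suc.prems(1)] Suc.hyps by metis
  obtain t' where t': "t' \<in> V" "(v, t') \<in> E" "D u' t' = m"
    using gdist_Suc_neighbor[OF assms(4) Suc.prems(1)] Suc.hyps Suc.prems by metis
  have "D x t \<le> D x u + D u t" "D x t' \<le> D x u' + D u' t'"
    using gdist_triangle[of x u t] gdist_triangle[of x u' t'] assms(1,3,4) t(1) t'(1) by auto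
  then have xt: "D x v = Suc (D x t)" "D x v = Suc (D x t')"
    using gdist_adj_cases[OF assms(1) t(2)] gdist_adj_cases[OF assms(1) t'(2)]
      Suc.hyps Suc.prems t t' assms(5) by auto
  then have "t = t'" using closer_neighbor_unique[OF assms(1) t(2) t'(2)] by blast
  with t' have "D u' t = m" by simp
  moreover have "D x t = D x u + D u t"
    using xt(1) Suc.prems(3) Suc.hyps(2) t(3) by linarith
  ultimately show ?case using Suc.hyps(1)[of t] t by metis
qed

lemma geodesic_point_exists:
  assumes "x \<in> V" "v \<in> V" "k \<le> D x v"
  shows "\<exists>u\<in>V. D x u = k \<and> D u v = D x v - k"
  using assms(2,3)
proof (induction "D x v" arbitrary: v)
  case 0
  then show ?case using assms(1) by (intro bexI[of _ x]) (auto simp: gdist_self)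
next
  case (Suc m)
  show ?case
  proof (cases "k = D x v")
    case True
    then show ?thesis using Suc by (intro bexI[of _ v]) (auto simp: gdist_self)
  next
    case False
    obtain t where t: "t \<in> V" "(v, t) \<in> E" "D x t = m"
      using gdist_Suc_neighbor[OF assms(1) Suc.prems(1)] Suc.hyps by metis
    obtain u where u: "u \<in> V" "D x u = k" "D u t = m - k"
      using Suc.hyps(1)[of t] t False Suc by auto
    have "D u v \<le> D u t + D t v" "D x v \<le> D x u + D u v" "D t v \<le> 1"
      using gdist_triangle[of u t v] gdist_triangle[of x u v] gdist_adj_le[of t v] assms(1)
        u(1) t Suc.prems(1) adj_sym[OF t(2)] by auto
    then show ?thesis using u Suc.hyps(2) Suc.prems(2) False t by (intro bexI[of _ u]) auto
  qed
qed

text \<open>With \<open>x\<close> as root, the last inequality says that \<open>k\<close> is at most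
  the Gromov product of \<open>v\<close> and \<open>w\<close>, the depth at which their branches
  part. The induction moves \<open>w\<close> one step towards \<open>v\<close>.\<close>

lemma common_ancestor:
  assumes "x \<in> V" "v \<in> V" "w \<in> V" "k \<le> D x v" "k \<le> D x w" "D v w + 2 * k \<le> D x v + D x w"
  shows "\<exists>u\<in>V. D x u = k \<and> D u v + k = D x v \<and> D u w + k = D x w"
  using assms(3,5,6)
proof (induction "D v w" arbitrary: w)
  case 0
  then have "v = w" using assms(2) gdist_eq_0_iff by auto
  then show ?case using geodesic_point_exists[OF assms(1,2,4)] assms(4) by auto
next
  case (Suc m)
  obtain w' where w': "w' \<in> V" "(w, w') \<in> E" "D v w' = m"
    using gdist_Suc_neighbor[OF assms(2) Suc.prems(1)] Suc.hyps by metis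
  have tri: "D x v \<le> D x w' + D w' v"
    using gdist_triangle[of x w' v] assms(1,2) w'(1) by auto
  show ?case
  \<comment> \<open>If \<open>w'\<close> is farther from \<open>x\<close>, the ancestor of
    \<open>w\<close> at depth \<open>k\<close> is also one of \<open>w'\<close>, and uniqueness
    identifies the two. If \<open>w'\<close> is nearer, its ancestor serves for
    \<open>w\<close>.\<close>
  proof (cases "D x w' = Suc (D x w)")
    case True
    then obtain u where u: "u \<in> V" "D x u = k" "D u v + k = D x v" "D u w' + k = D x w'"
      using Suc.hyps(1)[of w'] Suc.hyps(2) Suc.prems w' by auto
    obtain u' where u': "u' \<in> V" "D x u' = k" "D u' w = D x w - k"
      using geodesic_point_exists[OF assms(1) Suc.prems(1,2)] by auto
    have "D u' w' \<le> D u' w + D w w'" "D w w' \<le> 1" "D x w' \<le> D x u' + D u' w'"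
      using gdist_triangle[of u' w w'] gdist_triangle[of x u' w'] gdist_adj_le[of w w'] assms(1)
        u'(1) w' Suc.prems(1) by auto
    then have "D u' w' + k = D x w'" using True u' Suc.prems by auto
    then have "u = u'" using geodesic_point_unique[of x w' u u'] assms u u' w' by auto
    then show ?thesis using u u' Suc.prems(2) by auto
  next
    case False
    then have w: "D x w = Suc (D x w')" using gdist_adj_cases[OF assms(1) w'(2)] by metis
    have "k \<le> D x w'"
      using tri w Suc.prems Suc.hyps(2) w'(3) gdist_sym[of v w'] by simp
    then obtain u where u: "u \<in> V" "D x u = k" "D u v + k = D x v" "D u w' + k = D x w'"
      using Suc.hyps(1)[of w'] Suc.hyps(2) Suc.prems w' w by auto
    have "D u w \<le> D u w' + D w' w" "D w' w \<le> 1" "D x w \<le> D x u + D u w"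
      using gdist_triangle[of u w' w] gdist_triangle[of x u w] gdist_adj_le[of w' w] assms(1)
        u(1) w' Suc.prems(1) adj_sym[OF w'(2)] by auto
    then show ?thesis using u w by (intro bexI[of _ u]) auto
  qed
qed

text \<open>With \<open>x\<close> as root, \<open>2 * k\<close> is the smaller of the doubled Gromov products of \<open>v, y\<close> and of
  \<open>w, y\<close>; the ancestors of \<open>v\<close> and \<open>w\<close> at depth \<open>k\<close> both equal that of \<open>y\<close>.\<close>

lemma four_point:
  assumes "x \<in> V" "y \<in> V" "v \<in> V" "w \<in> V"
  shows "D v w + D x y \<le> max (D x v + D y w) (D x w + D y v)"
proof -
  have aux: "D v w + D x y \<le> D x w + D y v"
    if V: "v \<in> V" "w \<in> V" and le: "D x v + D y w \<le> D x w + D y v" for v w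
  proof -
    \<comment> \<open>Parity makes the doubled Gromov product even, so the depth \<open>k\<close> is
      an integer.\<close>
    have "even (D x v + D x y + D y v)"
      using gdist_parity[OF assms(1,2) V(1)] by (simp add: ac_simps)
    moreover have tri: "D y v \<le> D x v + D x y" "D x v \<le> D x y + D y v" "D x y \<le> D x v + D y v"
      using gdist_triangle[of y x v] gdist_triangle[of x y v] gdist_triangle[of x v y]
        gdist_sym[of y x] gdist_sym[of v y] V assms by auto
    ultimately obtain k where k: "D x v + D x y = D y v + 2 * k"
      by (metis add.commute even_add even_diff_nat dvd_def le_add_diff_inverse)
    have kle: "k \<le> D x v" "k \<le> D x y" using k tri by linarith+
    have "D x y \<le> D x w + D y w" "D x w \<le> D x y + D y w" "D y w \<le> D x w + D x y"
      using gdist_triangle[of x w y] gdist_triangle[of x y w] gdist_triangle[of y x w]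
        gdist_sym[of y x] gdist_sym[of w y] V assms by auto
    then have kw: "k \<le> D x w" "D w y + 2 * k \<le> D x w + D x y"
      using k le gdist_sym[of w y] by linarith+
    obtain u where u: "u \<in> V" "D x u = k" "D u v + k = D x v" "D u y + k = D x y"
      using common_ancestor[OF assms(1) V(1) assms(2) kle] k gdist_sym[of v y] by auto
    obtain u' where u': "u' \<in> V" "D x u' = k" "D u' w + k = D x w" "D u' y + k = D x y"
      using common_ancestor[OF assms(1) V(2) assms(2) kw(1) kle(2) kw(2)] by auto
    have "u = u'" using geodesic_point_unique[of x y u u'] assms u u' by auto
    moreover have "D v w \<le> D u v + D u w"
      using gdist_triangle[of v u w] gdist_sym[of v u] V u by auto
    ultimately show ?thesis using u u' k by simp
  qed
  show ?thesis
    using aux[OF assms(3,4)] aux[OF assms(4,3)] gdist_sym[of v w]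
    by (cases "D x v + D y w \<le> D x w + D y v") auto
qed

end

section \<open>Optimal transport between two spheres\<close>

text \<open>Glues the four partial matchings of \<open>ex_tight_bijection\<close>.\<close>

lemma relational_bij_Un:
  assumes "\<exists>\<phi>. bij_betw \<phi> S T \<and> (\<forall>v\<in>S. R v (\<phi> v))"
    and "\<exists>\<phi>. bij_betw \<phi> S' T' \<and> (\<forall>v\<in>S'. R v (\<phi> v))"
    and "S \<inter> S' = {}" "T \<inter> T' = {}"
  shows "\<exists>\<phi>. bij_betw \<phi> (S \<union> S') (T \<union> T') \<and> (\<forall>v\<in>S \<union> S'. R v (\<phi> v))"
proof -
  obtain \<phi> \<phi>' where \<phi>: "bij_betw \<phi> S T" "\<forall>v\<in>S. R v (\<phi> v)"
    and \<phi>': "bij_betw \<phi>' S' T'" "\<forall>v\<in>S'. R v (\<phi>' v)"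
    using assms by blast
  define \<psi> where "\<psi> v = (if v \<in> S then \<phi> v else \<phi>' v)" for v
  have "bij_betw \<psi> S T"
    using \<phi>(1) by (rule bij_betw_cong[THEN iffD1, rotated]) (simp add: \<psi>_def)
  moreover have "bij_betw \<psi> S' T'"
    using \<phi>'(1) by (rule bij_betw_cong[THEN iffD1, rotated]) (use assms(3) in \<open>auto simp: \<psi>_def\<close>)
  ultimately have "bij_betw \<psi> (S \<union> S') (T \<union> T')"
    using assms(4) by (rule bij_betw_combine)
  then show ?thesis using \<phi>(2) \<phi>'(2) by (intro exI[of _ \<psi>]) (auto simp: \<psi>_def)
qed

lemma expectation_fst_coupling:
  fixes f :: "'a \<Rightarrow> real"
  assumes "\<pi> \<in> couplings \<mu> \<nu>"
  shows "measure_pmf.expectation \<pi> (\<lambda>x. f (fst x)) = measure_pmf.expectation \<mu> f"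
  using assms integral_map_pmf[of fst \<pi> f] by (auto simp: couplings_def)

lemma expectation_snd_coupling:
  fixes f :: "'b \<Rightarrow> real"
  assumes "\<pi> \<in> couplings \<mu> \<nu>"
  shows "measure_pmf.expectation \<pi> (\<lambda>x. f (snd x)) = measure_pmf.expectation \<nu> f"
  using assms integral_map_pmf[of snd \<pi> f] by (auto simp: couplings_def)

text \<open>Kantorovich duality with an explicit optimal pair: \<open>f\<close> is the dual potential and the graph
  of \<open>\<phi>\<close> is the optimal plan.\<close>

lemma W1_pmf_of_set_eq:
  fixes f :: "'a \<Rightarrow> real"
  assumes S: "finite S" "S \<noteq> {}" and bij: "bij_betw \<phi> S T"
    and tight: "\<And>v. v \<in> S \<Longrightarrow> real (gdist G v (\<phi> v)) = f v - f (\<phi> v)"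
    and lip: "\<And>v w. v \<in> S \<Longrightarrow> w \<in> T \<Longrightarrow> f v - f w \<le> real (gdist G v w)"
  shows "W1 G (pmf_of_set S) (pmf_of_set T) = (sum f S - sum f T) / real (card S)"
proof (rule antisym)
  have T: "finite T" "T \<noteq> {}" "card T = card S" "T = \<phi> ` S"
    using S bij bij_betw_finite bij_betw_same_card by (auto simp: bij_betw_def card_image)
  obtain \<pi> where \<pi>: "\<pi> \<in> couplings (pmf_of_set S) (pmf_of_set T)"
      "W1 G (pmf_of_set S) (pmf_of_set T) = transport_cost G \<pi>"
      "\<And>\<pi>'. \<pi>' \<in> couplings (pmf_of_set S) (pmf_of_set T) \<Longrightarrow>
         transport_cost G \<pi> \<le> transport_cost G \<pi>'"
    using W1_minimum[of "pmf_of_set S" "pmf_of_set T" G] S T by auto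
  define \<rho> where "\<rho> = map_pmf (\<lambda>v. (v, \<phi> v)) (pmf_of_set S)"
  have "\<rho> \<in> couplings (pmf_of_set S) (pmf_of_set T)"
    using map_pmf_of_set_bij_betw[OF bij S(2,1)]
    by (simp add: couplings_def \<rho>_def pmf.map_comp o_def)
  then have "W1 G (pmf_of_set S) (pmf_of_set T) \<le> transport_cost G \<rho>"
    using \<pi> by simp
  also have "\<dots> = (\<Sum>v\<in>S. real (gdist G v (\<phi> v))) / real (card S)"
    unfolding transport_cost_def \<rho>_def using S by (simp add: integral_pmf_of_set)
  also have "(\<Sum>v\<in>S. real (gdist G v (\<phi> v))) = sum f S - (\<Sum>v\<in>S. f (\<phi> v))"
    using tight by (simp add: sum_subtractf)
  also have "(\<Sum>v\<in>S. f (\<phi> v)) = sum f T"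
    using bij by (rule sum.reindex_bij_betw)
  finally show "W1 G (pmf_of_set S) (pmf_of_set T) \<le> (sum f S - sum f T) / real (card S)" .
  have sub: "set_pmf \<pi> \<subseteq> S \<times> T" using couplings_subset[OF \<pi>(1)] S T by simp
  then have fin: "finite (set_pmf \<pi>)" using S T finite_subset by blast
  \<comment> \<open>Weak duality: the bound \<open>lip\<close> is integrated against the optimal
    plan, whose support lies in \<open>S \<times> T\<close> by \<open>sub\<close>.\<close>
  have "(sum f S - sum f T) / real (card S)
      = measure_pmf.expectation (pmf_of_set S) f - measure_pmf.expectation (pmf_of_set T) f"
    using S T by (simp add: integral_pmf_of_set diff_divide_distrib)
  also have "\<dots> = measure_pmf.expectation \<pi> (\<lambda>x. f (fst x) - f (snd x))"
    unfolding expectation_fst_coupling[OF \<pi>(1), symmetric]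
      expectation_snd_coupling[OF \<pi>(1), symmetric]
    by (intro Bochner_Integration.integral_diff[symmetric] integrable_measure_pmf_finite fin)
  also have "\<dots> \<le> transport_cost G \<pi>"
    unfolding transport_cost_def
    by (intro integral_mono_AE integrable_measure_pmf_finite fin)
       (use sub lip in \<open>auto simp: AE_measure_pmf_iff\<close>)
  finally show "(sum f S - sum f T) / real (card S) \<le> W1 G (pmf_of_set S) (pmf_of_set T)"
    using \<pi>(2) by simp
qed

section \<open>The dual potential and its Lipschitz bound\<close>

context tree_graph
begin

text \<open>The signed distance to the midpoint of the geodesic from \<open>x\<close> to \<open>y\<close>, positive on the side of
  \<open>x\<close>; it vanishes on the whole branch attached to a midpoint that is a vertex.\<close>

definition potential :: "'a \<Rightarrow> 'a \<Rightarrow> 'a \<Rightarrow> real" where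
  "potential x y v =
     (if D x v < D y v then real (D y v) - real (D x y) / 2
      else if D y v < D x v then real (D x y) / 2 - real (D x v)
      else 0)"

lemma potential_swap: "potential y x v = - potential x y v"
  using gdist_sym[of x y] by (auto simp: potential_def)

text \<open>The four point condition gives both inequalities. In its first instance the right-hand
  side is the maximum; in the second, strictness puts the entry \<open>D x v + D w y\<close> below
  the left-hand side, so the other entry must be the bound.\<close>

lemma gdist_opposite_sides:
  assumes "x \<in> V" "y \<in> V" "v \<in> V" "w \<in> V" "D x v < D y v" "D y w \<le> D x w"
  shows "D v w + D x y = D y v + D x w"
proof -
  have "D v w + D x y \<le> max (D x v + D y w) (D x w + D y v)"
    using assms by (intro four_point)
  moreover have "D y v + D x w \<le> max (D x y + D w v) (D x v + D w y)"
    using assms by (intro four_point)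
  ultimately show ?thesis
    using gdist_sym[of w v] gdist_sym[of w y] assms(5,6) by linarith
qed

text \<open>On one side the triangle inequality suffices. If \<open>v\<close> is on the side of
  \<open>x\<close> or in the middle branch, and \<open>w\<close> on the side of \<open>y\<close> or
  in the middle branch, not both in the middle, \<open>gdist_opposite_sides\<close> gives the
  distance. In all other positions the left side is at most 0, since the potential is nonnegative
  towards \<open>x\<close> and nonpositive towards \<open>y\<close>.\<close>

lemma potential_Lipschitz:
  assumes "x \<in> V" "y \<in> V" "v \<in> V" "w \<in> V"
  shows "potential x y v - potential x y w \<le> real (D v w)"
proof -
  have tri: "D y v \<le> D y w + D v w" "D x w \<le> D x v + D v w"
      "D x y \<le> D x v + D y v" "D x y \<le> D x w + D y w"
    using gdist_triangle[of y w v] gdist_triangle[of x v w] gdist_triangle[of x v y]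
      gdist_triangle[of x w y] gdist_sym[of w v] gdist_sym[of v y] gdist_sym[of w y] assms by auto
  have opp: "D v w + D x y = D y v + D x w" if "D x v < D y v" "D y w \<le> D x w"
    using gdist_opposite_sides[OF assms] that by blast
  have opp': "D v w + D x y = D y v + D x w" if "D y w < D x w" "D x v \<le> D y v"
    using gdist_opposite_sides[OF assms(2,1,4,3)] that gdist_sym[of w v] gdist_sym[of y x] by simp
  show ?thesis
    using tri opp opp' unfolding potential_def by (auto simp: field_simps)
qed

end

section \<open>Neighbours of a vertex relative to two base points\<close>

locale regular_tree_graph = tree_graph G for G :: "'a pair_pre_digraph" +
  fixes q :: nat
  assumes degree: "v \<in> pverts G \<Longrightarrow> out_degree (with_proj G) v = q + 1"
    and q_ge_2: "q \<ge> 2"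
begin

definition neighbors :: "'a \<Rightarrow> 'a set" where
  "neighbors v = {u. (v, u) \<in> E}"

lemma card_neighbors: "v \<in> V \<Longrightarrow> card (neighbors v) = q + 1"
proof -
  assume "v \<in> V"
  have "out_arcs (with_proj G) v = Pair v ` neighbors v"
    by (auto simp: neighbors_def)
  then show ?thesis
    using degree[OF \<open>v \<in> V\<close>] by (simp add: out_degree_def card_image inj_on_def)
qed

lemma finite_neighbors: "v \<in> V \<Longrightarrow> finite (neighbors v)"
  using card_neighbors[of v] card.infinite by fastforce

definition closer :: "'a \<Rightarrow> 'a \<Rightarrow> 'a set" where
  "closer x v = {u \<in> neighbors v. D x v = Suc (D x u)}"

text \<open>These are the children of \<open>v\<close> when every branch is rooted at the geodesic
  from \<open>x\<close> to \<open>y\<close>.\<close>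

definition children :: "'a \<Rightarrow> 'a \<Rightarrow> 'a \<Rightarrow> 'a set" where
  "children x y v = {u \<in> neighbors v. D x u = Suc (D x v) \<and> D y u = Suc (D y v)}"

lemma card_closer:
  assumes "x \<in> V" "v \<in> V"
  shows "card (closer x v) = (if v = x then 0 else 1)"
proof (cases "v = x")
  case True
  then show ?thesis using assms by (simp add: closer_def gdist_self)
next
  case False
  then obtain k where k: "D x v = Suc k"
    using gdist_eq_0_iff assms by (metis not0_implies_Suc)
  obtain u where u: "(v, u) \<in> E" "D x u = k"
    using gdist_Suc_neighbor[OF assms k] by blast
  have "closer x v = {u}"
  proof (intro equalityI subsetI)
    fix t assume "t \<in> closer x v"
    then show "t \<in> {u}"
      using closer_neighbor_unique[OF assms(1) _ u(1), of t] u(2) k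
      by (simp add: closer_def neighbors_def)
  qed (use u k in \<open>simp add: closer_def neighbors_def\<close>)
  then show ?thesis using False by simp
qed

lemma children_eq:
  assumes "x \<in> V" "y \<in> V"
  shows "children x y v = neighbors v - (closer x v \<union> closer y v)"
proof -
  have "D z u = Suc (D z v) \<longleftrightarrow> D z v \<noteq> Suc (D z u)" if "z \<in> V" "(v, u) \<in> E" for z u
  proof -
    have "D z u = Suc (D z v) \<or> D z v = Suc (D z u)" using gdist_adj_cases[OF that] by metis
    then show ?thesis by linarith
  qed
  then show ?thesis
    using assms unfolding children_def closer_def neighbors_def by blast
qed

text \<open>The paths from \<open>v\<close> to \<open>x\<close> and to \<open>y\<close> share their
  first edge: for a step that approaches \<open>x\<close> but recedes from \<open>y\<close>, both
  entries of the four point maximum would be too small.\<close>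

lemma closer_eq_if_off_geodesic:
  assumes "x \<in> V" "y \<in> V" "v \<in> V" "D x y < D x v + D y v"
  shows "closer x v = closer y v"
proof -
  have *: "D y v = Suc (D y u)"
    if V: "x \<in> V" "y \<in> V" and off: "D x y < D x v + D y v"
      and u: "(v, u) \<in> E" "D x v = Suc (D x u)" for x y u
  proof (rule ccontr)
    assume "D y v \<noteq> Suc (D y u)"
    then have "D y u = Suc (D y v)" using gdist_adj_cases[OF V(2) u(1)] by metis
    moreover have uV: "u \<in> V" using u(1) wellformed' by blast
    moreover have "D y u + D x v \<le> max (D x y + D v u) (D x u + D v y)"
      using V assms(3) uV by (intro four_point)
    ultimately show False
      using u off gdist_adj_le[OF u(1)] gdist_sym[of v y] by linarith
  qed
  show ?thesis
    using *[OF assms(1,2,4)] *[OF assms(2,1)] assms(4)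
    unfolding closer_def neighbors_def gdist_sym[of y x] add.commute[of "D y v"] by blast
qed

text \<open>A step approaching both ends would give a path from \<open>x\<close> to \<open>y\<close>
  shorter than \<open>D x y\<close>.\<close>

lemma closer_disjoint_on_geodesic:
  assumes "x \<in> V" "y \<in> V" "v \<in> V" "D x y = D x v + D y v"
  shows "closer x v \<inter> closer y v = {}"
proof -
  have False if "(v, u) \<in> E" "D x v = Suc (D x u)" "D y v = Suc (D y u)" for u
  proof -
    have "u \<in> V" using that wellformed' by blast
    then have "D x y \<le> D x u + D y u"
      using gdist_triangle[of x u y] gdist_sym[of u y] assms by simp
    then show False using that assms(4) by simp
  qed
  then show ?thesis unfolding closer_def neighbors_def by blast
qed

lemma card_children_off_geodesic:
  assumes "x \<in> V" "y \<in> V" "v \<in> V" "D x y < D x v + D y v"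
  shows "card (children x y v) = q"
proof -
  have "v \<noteq> x" using assms gdist_sym[of x y] by (auto simp: gdist_self)
  then show ?thesis
    using assms card_closer[of x v] closer_eq_if_off_geodesic[OF assms] finite_neighbors[of v]
    by (simp add: children_eq card_neighbors card_Diff_subset closer_def)
qed

lemma card_children_on_geodesic:
  assumes "x \<in> V" "y \<in> V" "v \<in> V" "D x y = D x v + D y v"
  shows "card (children x y v) = q + 1 - ((if v = x then 0 else 1) + (if v = y then 0 else 1))"
proof -
  have fin: "finite (closer x v)" "finite (closer y v)"
    using finite_neighbors[OF assms(3)] by (auto simp: closer_def)
  have "card (closer x v \<union> closer y v) = (if v = x then 0 else 1) + (if v = y then 0 else 1)"
    using card_Un_disjoint[OF fin closer_disjoint_on_geodesic[OF assms]] assms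
    by (simp add: card_closer)
  moreover have "closer x v \<union> closer y v \<subseteq> neighbors v" by (auto simp: closer_def)
  ultimately show ?thesis
    using assms fin by (simp add: children_eq card_neighbors card_Diff_subset)
qed

text \<open>Even at an inner vertex of the geodesic, where two neighbours are lost,
  \<open>q \<ge> 2\<close> leaves one.\<close>

lemma ex_child:
  assumes "x \<in> V" "y \<in> V" "v \<in> V"
  shows "\<exists>u\<in>V. (v, u) \<in> E \<and> D x u = Suc (D x v) \<and> D y u = Suc (D y v)"
proof -
  have "D x y \<le> D x v + D y v"
    using gdist_triangle[of x v y] gdist_sym[of v y] assms by simp
  then have "card (children x y v) > 0"
    using card_children_off_geodesic[OF assms] card_children_on_geodesic[OF assms] q_ge_2
    by (cases "D x y = D x v + D y v") auto
  then obtain u where "u \<in> children x y v" by (metis card.empty ex_in_conv less_irrefl)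
  then show ?thesis unfolding children_def neighbors_def using wellformed'(2) by blast
qed

lemma ex_descendant:
  assumes "x \<in> V" "y \<in> V" "w \<in> V"
  shows "\<exists>v\<in>V. D x v = D x w + k \<and> D y v = D y w + k \<and> D w v = k"
proof -
  \<comment> \<open>The induction keeps only an upper bound on \<open>D w v\<close>; the triangle
    inequality with \<open>D x v = D x w + k\<close> turns it into an equality.\<close>
  have "\<exists>v\<in>V. D x v = D x w + k \<and> D y v = D y w + k \<and> D w v \<le> k"
  proof (induction k)
    case 0
    then show ?case using assms by (intro bexI[of _ w]) (auto simp: gdist_self)
  next
    case (Suc k)
    then obtain v where v: "v \<in> V" "D x v = D x w + k" "D y v = D y w + k" "D w v \<le> k" by blast
    obtain u where u: "u \<in> V" "(v, u) \<in> E" "D x u = Suc (D x v)" "D y u = Suc (D y v)"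
      using ex_child[OF assms(1,2) v(1)] by blast
    have "D w u \<le> D w v + D v u" by (rule gdist_triangle) (use assms u v in auto)
    then show ?case using u v gdist_adj_le[OF u(2)] by (intro bexI[of _ u]) auto
  qed
  then obtain v where v: "v \<in> V" "D x v = D x w + k" "D y v = D y w + k" "D w v \<le> k" by blast
  have "D x v \<le> D x w + D w v" by (rule gdist_triangle) (use assms v in auto)
  then show ?thesis using v by (intro bexI[of _ v]) auto
qed

text \<open>A vertex of the sphere around \<open>y\<close> that is nearer to \<open>x\<close> is reached from one of its
  descendants in the sphere around \<open>x\<close>; the descendant determines it.\<close>

lemma ex_injection_to_descendants:
  assumes "x \<in> V" "y \<in> V"
  shows "\<exists>g. inj_on g {w \<in> gsphere G y n. D x w < n} \<and>
    (\<forall>w \<in> gsphere G y n. D x w < n \<longrightarrow>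
       g w \<in> gsphere G x n \<and> D y (g w) + D x w = 2 * n \<and> D (g w) w + D x w = n)"
proof -
  let ?A = "{w \<in> gsphere G y n. D x w < n}"
  have "\<forall>w\<in>?A. \<exists>v. v \<in> V \<and> D x v = n \<and> D y v + D x w = 2 * n \<and> D v w + D x w = n"
  proof
    fix w assume w: "w \<in> ?A"
    then have "w \<in> V" "D y w = n" "D x w < n" by (auto simp: gsphere_def)
    moreover obtain v where "v \<in> V" "D x v = D x w + (n - D x w)" "D y v = D y w + (n - D x w)"
        "D w v = n - D x w"
      using ex_descendant[OF assms \<open>w \<in> V\<close>] by blast
    ultimately show "\<exists>v. v \<in> V \<and> D x v = n \<and> D y v + D x w = 2 * n \<and> D v w + D x w = n"
      using gdist_sym[of w v] by (intro exI[of _ v]) auto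
  qed
  then obtain g where g: "\<And>w. w \<in> ?A \<Longrightarrow>
      g w \<in> V \<and> D x (g w) = n \<and> D y (g w) + D x w = 2 * n \<and> D (g w) w + D x w = n"
    by metis
  have "inj_on g ?A"
  proof (rule inj_onI)
    fix w w' assume w: "w \<in> ?A" "w' \<in> ?A" "g w = g w'"
    have V: "w \<in> V" "w' \<in> V" "D y w = n" "D y w' = n" using w by (auto simp: gsphere_def)
    have "D x w = D x w'" using g[OF w(1)] g[OF w(2)] w(3) by auto
    \<comment> \<open>\<open>w\<close> is the vertex at distance \<open>n\<close> from
      \<open>y\<close> on the geodesic from \<open>y\<close> to \<open>g w\<close>.\<close>
    then show "w = w'"
      using geodesic_point_unique[of y "g w" w w'] assms V g[OF w(1)] g[OF w(2)] w(3)
        gdist_sym[of w "g w"] gdist_sym[of w' "g w"] by auto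
  qed
  then show ?thesis using g by (intro exI[of _ g]) (auto simp: gsphere_def)
qed

lemma ex_tight_bijection:
  assumes xy: "x \<in> V" "y \<in> V"
    and fin: "finite (gsphere G x n)" "finite (gsphere G y n)"
    and card: "card (gsphere G x n) = card (gsphere G y n)"
  shows "\<exists>\<phi>. bij_betw \<phi> (gsphere G x n) (gsphere G y n) \<and>
    (\<forall>v\<in>gsphere G x n. real (D v (\<phi> v)) = potential x y v - potential x y (\<phi> v))"
proof -
  let ?R = "\<lambda>v w. real (D v w) = potential x y v - potential x y w"
  define S T A B C where "S = gsphere G x n" and "T = gsphere G y n"
    and "A = {w \<in> T. D x w < n}" and "B = {v \<in> S. D y v < n}" and "C = S \<inter> T"
  note defs = S_def T_def A_def B_def C_def
  have S: "v \<in> V" "D x v = n" if "v \<in> S" for v using that by (auto simp: S_def gsphere_def)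
  have T: "v \<in> V" "D y v = n" if "v \<in> T" for v using that by (auto simp: T_def gsphere_def)
  obtain g where g: "inj_on g A"
    "\<And>w. w \<in> A \<Longrightarrow> g w \<in> S \<and> D y (g w) + D x w = 2 * n \<and> D (g w) w + D x w = n"
    using ex_injection_to_descendants[OF xy] unfolding defs by blast
  obtain h where h: "inj_on h B"
    "\<And>v. v \<in> B \<Longrightarrow> h v \<in> T \<and> D x (h v) + D y v = 2 * n \<and> D (h v) v + D y v = n"
    using ex_injection_to_descendants[OF xy(2,1)] unfolding defs by blast
  define S' T' where "S' = S - (g ` A \<union> B \<union> C)" and "T' = T - (A \<union> h ` B \<union> C)"
  \<comment> \<open>The images under \<open>g\<close> lie farther than \<open>n\<close> from
    \<open>y\<close>, which separates them from \<open>B\<close> and \<open>C\<close>.\<close>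
  have far: "g w \<in> S" "n < D y (g w)" if "w \<in> A" for w
    using g(2)[OF that] that by (auto simp: A_def)
  have far': "h v \<in> T" "n < D x (h v)" if "v \<in> B" for v
    using h(2)[OF that] that by (auto simp: B_def)
  have dS: "g ` A \<inter> B = {}" "(g ` A \<union> B) \<inter> C = {}" "(g ` A \<union> B \<union> C) \<inter> S' = {}"
    using far T by (fastforce simp: B_def C_def S'_def)+
  have dT: "A \<inter> h ` B = {}" "(A \<union> h ` B) \<inter> C = {}" "(A \<union> h ` B \<union> C) \<inter> T' = {}"
    using far' S by (fastforce simp: A_def C_def T'_def)+
  have eS: "g ` A \<union> B \<union> C \<union> S' = S" using far by (auto simp: B_def C_def S'_def)
  have eT: "A \<union> h ` B \<union> C \<union> T' = T" using far' by (auto simp: A_def C_def T'_def)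
  have finS: "finite S" "finite T" using fin by (auto simp: S_def T_def)
  have 1: "\<exists>\<phi>. bij_betw \<phi> (g ` A) A \<and> (\<forall>v\<in>g ` A. ?R v (\<phi> v))"
  proof (intro exI conjI)
    show "bij_betw (inv_into A g) (g ` A) A"
      using g(1) by (simp add: bij_betw_inv_into inj_on_imp_bij_betw)
    show "\<forall>v\<in>g ` A. ?R v (inv_into A g v)"
    proof clarify
      fix w assume w: "w \<in> A"
      have "w \<in> T" "D x w < n" using w by (auto simp: A_def)
      \<comment> \<open>Both vertices are nearer to \<open>x\<close>, so the potential drops by
        \<open>D y (g w) - n = n - D x w\<close>.\<close>
      then have "?R (g w) w"
        using g(2)[OF w] far[OF w] S[of "g w"] T[of w] by (auto simp: potential_def)
      then show "?R (g w) (inv_into A g (g w))" using w g(1) by simp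
    qed
  qed
  have 2: "\<exists>\<phi>. bij_betw \<phi> B (h ` B) \<and> (\<forall>v\<in>B. ?R v (\<phi> v))"
  proof (intro exI conjI ballI)
    show "bij_betw h B (h ` B)" using h(1) by (rule inj_on_imp_bij_betw)
    fix v assume v: "v \<in> B"
    have "v \<in> S" "D y v < n" using v by (auto simp: B_def)
    then show "?R v (h v)"
      using h(2)[OF v] far'[OF v] S[of v] T[of "h v"] gdist_sym[of v "h v"]
      by (auto simp: potential_def)
  qed
  have 3: "\<exists>\<phi>. bij_betw \<phi> C C \<and> (\<forall>v\<in>C. ?R v (\<phi> v))"
    using S by (intro exI[of _ id]) (auto simp: C_def gdist_self)
  have 4: "\<exists>\<phi>. bij_betw \<phi> S' T' \<and> (\<forall>v\<in>S'. ?R v (\<phi> v))"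
  proof -
    have f: "finite A" "finite B" "finite C" "finite S'" "finite T'"
      using finS by (auto simp: A_def B_def C_def S'_def T'_def)
    \<comment> \<open>Both spheres lose \<open>card A + card B + card C\<close> vertices, so the
      remainders are equally large.\<close>
    have "card S = card A + card B + card C + card S'"
      unfolding eS[symmetric] using f dS g(1) by (simp add: card_Un_disjoint card_image)
    moreover have "card T = card A + card B + card C + card T'"
      unfolding eT[symmetric] using f dT h(1) by (simp add: card_Un_disjoint card_image)
    ultimately have "card S' = card T'" using card by (simp add: S_def T_def)
    then obtain \<phi> where \<phi>: "bij_betw \<phi> S' T'" using f finite_same_card_bij by blast
    have "?R v w" if "v \<in> S'" "w \<in> T'" for v w
    proof -
      have v: "v \<in> S" "v \<notin> B" "v \<notin> T" and w: "w \<in> T" "w \<notin> A" "w \<notin> S"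
        using that by (auto simp: S'_def T'_def C_def)
      \<comment> \<open>Outside \<open>B\<close> and \<open>T\<close>, \<open>v\<close> is farther
        than \<open>n\<close> from \<open>y\<close>; likewise \<open>w\<close> from
        \<open>x\<close>. The remainders thus lie on opposite sides.\<close>
      have "D y v \<noteq> n" "D x w \<noteq> n"
        using v w S[OF v(1)] T[OF w(1)] by (auto simp: S_def T_def gsphere_def)
      then have lt: "D x v < D y v" "D y w < D x w"
        using v w S[OF v(1)] T[OF w(1)] by (auto simp: A_def B_def)
      then have "D v w + D x y = D y v + D x w"
        using gdist_opposite_sides[OF xy S(1)[OF v(1)] T(1)[OF w(1)]] by simp
      then show ?thesis using lt by (simp add: potential_def)
    qed
    then show ?thesis using \<phi> by (metis bij_betwE)
  qed
  show ?thesis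
    using relational_bij_Un[OF relational_bij_Un[OF relational_bij_Un[OF 1 2 dS(1) dT(1)]
          3 dS(2) dT(2)] 4 dS(3) dT(3)]
    unfolding eS eT S_def T_def .
qed

end

section \<open>The mean value of the potential on a sphere\<close>

text \<open>Number of neighbours off the geodesic of its \<open>i\<close>-th vertex, for a geodesic of length
  \<open>d \<ge> 1\<close>.\<close>

definition side_degree :: "nat \<Rightarrow> nat \<Rightarrow> nat \<Rightarrow> nat" where
  "side_degree q d i = (if i = 0 \<or> i = d then q else q - 1)"

text \<open>The value of the potential on the sphere around \<open>x\<close>, at the vertices that project to the
  \<open>i\<close>-th vertex of the geodesic.\<close>

definition level_potential :: "nat \<Rightarrow> real \<Rightarrow> nat \<Rightarrow> real" where
  "level_potential d n i =
     (if 2 * i < d then n + real d / 2 - 2 * real i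
      else if d < 2 * i then real d / 2 - n else 0)"

section \<open>Counting the vertices of a sphere by their projection to the geodesic\<close>

context regular_tree_graph
begin

text \<open>\<open>level x y i h\<close> is the set of vertices at height \<open>h\<close> above the \<open>i\<close>-th vertex of the geodesic.\<close>

definition level :: "'a \<Rightarrow> 'a \<Rightarrow> nat \<Rightarrow> nat \<Rightarrow> 'a set" where
  "level x y i h = {v \<in> V. D x v = i + h \<and> D y v + i = D x y + h}"

lemma level_0:
  assumes "x \<in> V" "y \<in> V" "i \<le> D x y"
  shows "\<exists>u. level x y i 0 = {u}"
proof -
  obtain u where u: "u \<in> V" "D x u = i" "D u y = D x y - i"
    using geodesic_point_exists[OF assms] by blast
  have "v = u" if "v \<in> level x y i 0" for v
  proof (rule geodesic_point_unique[of x y])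
    have v: "v \<in> V" "D x v = i" "D v y + i = D x y"
      using that gdist_sym[of v y] by (auto simp: level_def)
    then show "v \<in> V" "D x v = D x u" "D v y = D u y" "D x y = D x v + D v y"
      using u by auto
  qed (use assms u in auto)
  moreover have "u \<in> level x y i 0" using u assms(3) gdist_sym[of u y] by (auto simp: level_def)
  ultimately show ?thesis by blast
qed

text \<open>Above the geodesic, the neighbour towards \<open>x\<close> is also the neighbour towards
  \<open>y\<close>, so it is the parent.\<close>

lemma level_Suc:
  assumes "x \<in> V" "y \<in> V" "i \<le> D x y"
  shows "level x y i (Suc h) = (\<Union>u\<in>level x y i h. children x y u)"
proof (intro equalityI subsetI)
  fix v assume "v \<in> level x y i (Suc h)"
  then have v: "v \<in> V" "D x v = Suc (i + h)" "D y v + i = Suc (D x y + h)"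
    by (auto simp: level_def)
  obtain u where u: "u \<in> V" "(v, u) \<in> E" "D x u = i + h"
    using gdist_Suc_neighbor[OF assms(1) v(1,2)] by blast
  have "D x y < D x v + D y v" using v by linarith
  then have "closer x v = closer y v"
    using closer_eq_if_off_geodesic assms v by blast
  moreover have "u \<in> closer x v" using u v by (auto simp: closer_def neighbors_def)
  ultimately have "D y v = Suc (D y u)" by (auto simp: closer_def)
  then show "v \<in> (\<Union>u\<in>level x y i h. children x y u)"
    using u v adj_sym[OF u(2)]
    by (intro UN_I[of u]) (auto simp: level_def children_def neighbors_def)
next
  fix v assume "v \<in> (\<Union>u\<in>level x y i h. children x y u)"
  then show "v \<in> level x y i (Suc h)"
    by (auto simp: level_def children_def neighbors_def dest: wellformed'(2))
qed

lemma children_disjoint: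
  assumes "x \<in> V" "u \<noteq> u'"
  shows "children x y u \<inter> children x y u' = {}"
proof -
  have "u = u'" if "(u, v) \<in> E" "(u', v) \<in> E" "D x v = Suc (D x u)" "D x v = Suc (D x u')" for v
    using closer_neighbor_unique[OF assms(1)] that adj_sym by blast
  then show ?thesis using assms(2) unfolding children_def neighbors_def by blast
qed

lemma finite_children: "u \<in> V \<Longrightarrow> finite (children x y u)"
  using finite_neighbors by (simp add: children_def)

lemma finite_level:
  assumes "x \<in> V" "y \<in> V" "i \<le> D x y"
  shows "finite (level x y i h)"
proof (induction h)
  case 0
  then show ?case using level_0[OF assms] by auto
next
  case (Suc h)
  have "finite (children x y u)" if "u \<in> level x y i h" for u
    using that finite_children by (auto simp: level_def)
  then show ?case using Suc by (simp add: level_Suc[OF assms])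
qed

lemma card_level_Suc:
  assumes "x \<in> V" "y \<in> V" "i \<le> D x y"
    and "\<And>u. u \<in> level x y i h \<Longrightarrow> card (children x y u) = c"
  shows "card (level x y i (Suc h)) = c * card (level x y i h)"
proof -
  have "card (level x y i (Suc h)) = (\<Sum>u\<in>level x y i h. card (children x y u))"
    unfolding level_Suc[OF assms(1-3)]
    using finite_level[OF assms(1-3)] children_disjoint[OF assms(1)] finite_children
    by (intro card_UN_disjoint) (auto simp: level_def)
  then show ?thesis using assms(4) by (simp add: mult.commute)
qed

text \<open>The single vertex of height 0 has \<open>side_degree\<close> children and every higher
  vertex has \<open>q\<close>, so the geometric pattern starts at height 1.\<close>

lemma card_level:
  assumes "x \<in> V" "y \<in> V" "i \<le> D x y" "1 \<le> D x y"
  shows "card (level x y i (Suc h)) = side_degree q (D x y) i * q ^ h"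
proof (induction h)
  case 0
  obtain u where u: "level x y i 0 = {u}" using level_0[OF assms(1-3)] by blast
  then have "u \<in> level x y i 0" by simp
  then have uV: "u \<in> V" "D x u = i" "D y u + i = D x y" by (auto simp: level_def)
  have "u = x \<longleftrightarrow> i = 0" "u = y \<longleftrightarrow> i = D x y"
    using uV gdist_eq_0_iff[of x u] gdist_eq_0_iff[of y u] assms by auto
  then have "card (children x y u) = side_degree q (D x y) i"
    using card_children_on_geodesic[OF assms(1,2) uV(1)] uV assms(4)
    by (auto simp: side_degree_def)
  then have "card (level x y i (Suc 0)) = side_degree q (D x y) i * card (level x y i 0)"
    using u by (intro card_level_Suc) (use assms in auto)
  then show ?case using u by simp
next
  case (Suc h)
  have "card (level x y i (Suc (Suc h))) = q * card (level x y i (Suc h))"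
    using assms(1-3) by (intro card_level_Suc card_children_off_geodesic) (auto simp: level_def)
  then show ?case using Suc by simp
qed

text \<open>The level index of \<open>v\<close> is the Gromov product of \<open>v\<close> and
  \<open>y\<close> based at \<open>x\<close>, an integer by parity; it marks the projection of
  \<open>v\<close> to the geodesic.\<close>

lemma gsphere_eq_levels:
  assumes "x \<in> V" "y \<in> V" "D x y < n"
  shows "gsphere G x n = (\<Union>i\<le>D x y. level x y i (n - i))"
proof (intro equalityI subsetI)
  fix v assume "v \<in> gsphere G x n"
  then have v: "v \<in> V" "D x v = n" by (auto simp: gsphere_def)
  have tri: "D x v \<le> D x y + D y v" "D y v \<le> D x y + D x v"
    using gdist_triangle[of x y v] gdist_triangle[of y x v] gdist_sym[of y x] assms v by auto
  have "even (D x v + D y v + D x y)" by (rule gdist_parity[OF assms(1,2) v(1)])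
  then have "even (D x y + D x v - D y v)" using tri by presburger
  then obtain i where "D x y + D x v - D y v = 2 * i" by blast
  then have "D y v + 2 * i = D x y + n" using tri v by linarith
  moreover from this have "i \<le> D x y" using tri v by linarith
  ultimately show "v \<in> (\<Union>i\<le>D x y. level x y i (n - i))"
    using v assms(3) by (intro UN_I[of i]) (auto simp: level_def)
qed (use assms(3) in \<open>auto simp: level_def gsphere_def\<close>)

lemma finite_gsphere:
  assumes "x \<in> V" "y \<in> V" "D x y < n"
  shows "finite (gsphere G x n)"
  using assms finite_level by (auto simp: gsphere_eq_levels)

lemma sum_gsphere:
  fixes f :: "'a \<Rightarrow> real"
  assumes "x \<in> V" "y \<in> V" "1 \<le> D x y" "D x y < n"
    and f: "\<And>v i. v \<in> level x y i (n - i) \<Longrightarrow> i \<le> D x y \<Longrightarrow> f v = F i"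
  shows "sum f (gsphere G x n) =
    real q ^ (n - 1) * (\<Sum>i\<le>D x y. real (side_degree q (D x y) i) * (1 / real q) ^ i * F i)"
proof -
  have "sum f (gsphere G x n) = (\<Sum>i\<le>D x y. sum f (level x y i (n - i)))"
    unfolding gsphere_eq_levels[OF assms(1,2,4)]
  proof (intro sum.UNION_disjoint ballI impI)
    fix i j assume "i \<in> {..D x y}" "j \<in> {..D x y}" "i \<noteq> j"
    then show "level x y i (n - i) \<inter> level x y j (n - j) = {}"
      using assms(4) by (auto simp: level_def)
  qed (use finite_level assms in auto)
  also have "\<dots> = (\<Sum>i\<le>D x y. real q ^ (n - 1) *
      (real (side_degree q (D x y) i) * (1 / real q) ^ i * F i))"
  proof (intro sum.cong refl)
    fix i assume "i \<in> {..D x y}"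
    \<comment> \<open>\<open>D x y < n\<close> keeps every height \<open>n - i\<close> positive, as
      \<open>card_level\<close> requires.\<close>
    then have i: "i \<le> D x y" "n - i = Suc (n - Suc i)" using assms(4) by auto
    have "sum f (level x y i (n - i)) = real (card (level x y i (n - i))) * F i"
      using f i(1) by simp
    also have "card (level x y i (n - i)) = side_degree q (D x y) i * q ^ (n - Suc i)"
      unfolding i(2) by (rule card_level) (use assms i in auto)
    also have "real (side_degree q (D x y) i * q ^ (n - Suc i))
        = real (side_degree q (D x y) i) * (real q ^ (n - 1) * (1 / real q) ^ i)"
    proof -
      have "n - 1 = (n - Suc i) + i" using i assms(4) by auto
      then have "real q ^ (n - 1) * (1 / real q) ^ i = real q ^ (n - Suc i)"
        using q_ge_2 by (simp add: power_add power_one_over)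
      then show ?thesis by simp
    qed
    finally show "sum f (level x y i (n - i)) = real q ^ (n - 1) *
        (real (side_degree q (D x y) i) * (1 / real q) ^ i * F i)" by simp
  qed
  finally show ?thesis by (simp add: sum_distrib_left)
qed

lemma sum_potential_gsphere:
  assumes "x \<in> V" "y \<in> V" "1 \<le> D x y" "D x y < n"
  shows "sum (potential x y) (gsphere G x n) = real q ^ (n - 1) *
    (\<Sum>i\<le>D x y. real (side_degree q (D x y) i) * (1 / real q) ^ i
       * level_potential (D x y) (real n) i)"
proof (rule sum_gsphere[OF assms])
  fix v i assume "v \<in> level x y i (n - i)" and i: "i \<le> D x y"
  then have "D x v = n" "real (D y v) = real (D x y) + real n - 2 * real i"
    using assms(4) by (auto simp: level_def)
  then show "potential x y v = level_potential (D x y) (real n) i"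
    by (auto simp: potential_def level_potential_def field_simps)
qed

end

section \<open>Closed forms of the weighted sums\<close>

lemma sum_side_degree:
  fixes q m d :: nat and a :: real
  assumes "q \<ge> 2" "m < d"
  shows "(\<Sum>i<Suc m. real (side_degree q d i) * (1 / real q) ^ i * (a - 2 * real i))
    = a * (real q + 1 - (1 / real q) ^ m)
      - 2 * (real q - (real (Suc m) * (real q - 1) + 1) * (1 / real q) ^ m) / (real q - 1)"
  using assms(2)
proof (induction m)
  case 0
  then show ?case using assms(1) by (simp add: side_degree_def field_simps)
next
  case (Suc m)
  define r where "r = (1 / real q) ^ m"
  \<comment> \<open>The bound on \<open>m\<close> keeps the endpoint \<open>d\<close>, whose weight
    differs, out of this arithmetic-geometric sum.\<close>
  have s: "real (side_degree q d (Suc m)) = real q - 1"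
    using Suc.prems assms(1) by (simp add: side_degree_def of_nat_diff)
  have "(\<Sum>i<Suc (Suc m). real (side_degree q d i) * (1 / real q) ^ i * (a - 2 * real i))
    = a * (real q + 1 - r) - 2 * (real q - (real (Suc m) * (real q - 1) + 1) * r) / (real q - 1)
      + (real q - 1) * (r / real q) * (a - 2 * real (Suc m))"
    using Suc by (simp add: s r_def)
  also have "\<dots> = a * (real q + 1 - r / real q)
      - 2 * (real q - (real (Suc (Suc m)) * (real q - 1) + 1) * (r / real q)) / (real q - 1)"
    using assms(1) by (simp add: field_simps)
  finally show ?case by (simp add: r_def)
qed

text \<open>Up to the factor \<open>real q ^ (n - 1)\<close> this counts the sphere vertices
  projecting beyond index \<open>m\<close>. The sum collapses from the end \<open>d\<close>, where
  the degree is \<open>q\<close> instead of \<open>q - 1\<close>.\<close>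

lemma sum_side_degree_upper:
  fixes q m d :: nat
  assumes "q \<ge> 2" "m < d"
  shows "(\<Sum>i=Suc m..d. real (side_degree q d i) * (1 / real q) ^ i) = (1 / real q) ^ m"
  using assms(2)
proof (induction "d - Suc m" arbitrary: m)
  case 0
  then have "d = Suc m" by simp
  then show ?case using assms(1) by (simp add: side_degree_def)
next
  case (Suc k)
  then have "Suc m < d" by simp
  then have "real (side_degree q d (Suc m)) = real q - 1"
    using assms(1) by (simp add: side_degree_def of_nat_diff)
  moreover have "(\<Sum>i=Suc (Suc m)..d. real (side_degree q d i) * (1 / real q) ^ i)
      = (1 / real q) ^ Suc m"
    using Suc.hyps(1)[of "Suc m"] Suc.hyps(2) \<open>Suc m < d\<close> by simp
  moreover have "(\<Sum>i=Suc m..d. real (side_degree q d i) * (1 / real q) ^ i)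
      = real (side_degree q d (Suc m)) * (1 / real q) ^ Suc m
        + (\<Sum>i=Suc (Suc m)..d. real (side_degree q d i) * (1 / real q) ^ i)"
    using \<open>Suc m < d\<close> by (intro sum.atLeast_Suc_atMost) simp
  ultimately have "(\<Sum>i=Suc m..d. real (side_degree q d i) * (1 / real q) ^ i)
      = (real q - 1) * (1 / real q) ^ Suc m + (1 / real q) ^ Suc m"
    by simp
  also have "\<dots> = (1 / real q) ^ m" using assms(1) by (simp add: field_simps)
  finally show ?case .
qed

lemma sum_side_degree_total:
  fixes q d :: nat
  assumes "q \<ge> 2" "d \<ge> 1"
  shows "(\<Sum>i\<le>d. real (side_degree q d i) * (1 / real q) ^ i) = real q + 1"
proof -
  have "{..d} = insert 0 {Suc 0..d}" by auto
  then show ?thesis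
    using sum_side_degree_upper[OF assms(1), of 0 d] assms(2) by (simp add: side_degree_def)
qed

text \<open>To be read with \<open>Q = q\<close>, \<open>a\<close> and \<open>b\<close> the upper
  and lower half of \<open>d\<close>, \<open>u = q powi (1 - a)\<close> and
  \<open>s = q powi (- b)\<close>; the two alternatives are even and odd \<open>d\<close>.\<close>

lemma sphere_constants_identity:
  fixes Q a b u s n d :: real
  assumes "Q > 1" "d = a + b" "a = b \<and> u = Q * s \<or> a = b + 1 \<and> u = s"
  shows "2 * ((n + d / 2) * (Q + 1 - u) - 2 * (Q - (a * (Q - 1) + 1) * u) / (Q - 1)
      + s * (d / 2 - n)) / (Q + 1)
    = 2 * (Q + 1 - u - s) / (Q + 1) * n
      + (d + (- 4 * Q + 2 * (a * (Q - 1) + 1) * u + 2 * (b * (Q - 1) + Q) * s) / (Q\<^sup>2 - 1))"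
proof -
  have fac: "Q\<^sup>2 - 1 = (Q - 1) * (Q + 1)" by algebra
  have nz: "Q - 1 \<noteq> 0" "Q + 1 \<noteq> 0" using assms(1) by auto
  from assms(3) show ?thesis
  proof (elim disjE conjE)
    assume eqs: "a = b" "u = Q * s"
    show ?thesis unfolding eqs assms(2) fac using nz by (simp add: divide_simps) algebra
  next
    assume eqs: "a = b + 1" "u = s"
    show ?thesis unfolding eqs assms(2) fac using nz by (simp add: divide_simps) algebra
  qed
qed

text \<open>The factor 2 stands for the two spheres, whose potential sums are opposite;
  \<open>q + 1\<close> is the total weight of \<open>sum_side_degree_total\<close>.\<close>

lemma sum_level_potential:
  fixes q d :: nat and n :: real
  assumes "q \<ge> 2" "d \<ge> 1"
  shows "2 * (\<Sum>i\<le>d. real (side_degree q d i) * (1 / real q) ^ i * level_potential d n i)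
    / (real q + 1) = A_sphere d q * n + B_sphere d q"
proof -
  let ?c = "\<lambda>i. real (side_degree q d i) * (1 / real q) ^ i"
  let ?t = "\<lambda>i. ?c i * level_potential d n i"
  have powi: "real q powi (- int k) = (1 / real q) ^ k" for k
    by (simp add: power_int_minus power_one_over inverse_eq_divide)
  have split: "sum ?t {..d} = sum ?t {..<k} + sum ?t {k..d}" if "k \<le> d" for k
  proof -
    have "{..d} = {..<k} \<union> {k..d}" using that by auto
    moreover have "{..<k} \<inter> {k..d} = {}" by auto
    ultimately show ?thesis by (simp only: sum.union_disjoint finite_lessThan finite_atLeastAtMost)
  qed
  show ?thesis
  proof (cases "even d")
    case True
    then obtain m where d: "d = Suc m + Suc m"
      using assms(2) by (metis evenE mult_2 not0_implies_Suc not_one_le_zero mult_0_right)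
    have fl: "\<lfloor>real d / 2\<rfloor> = int (Suc m)" "\<lceil>real d / 2\<rceil> = int (Suc m)"
      by (simp_all add: d floor_eq_iff ceiling_eq_iff field_simps)
    define r where "r = (1 / real q) ^ m"
    have pw: "real q powi (1 - int (Suc m)) = r" "real q powi (- int (Suc m)) = r / real q"
      using powi[of m] powi[of "Suc m"] by (simp_all add: r_def)
    \<comment> \<open>For even \<open>d\<close> the geodesic has a middle vertex, where the
      potential is 0; its term is split off.\<close>
    have "sum ?t {Suc m..d} = ?t (Suc m) + sum ?t {Suc (Suc m)..d}"
      by (intro sum.atLeast_Suc_atMost) (simp add: d)
    then have "sum ?t {..d} = sum ?t {..<Suc m} + (?t (Suc m) + sum ?t {Suc (Suc m)..d})"
      using split[of "Suc m"] by (simp add: d)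
    also have "?t (Suc m) = 0" by (simp add: level_potential_def d)
    also have "sum ?t {..<Suc m} = (\<Sum>i<Suc m. ?c i * ((n + real d / 2) - 2 * real i))"
      by (intro sum.cong) (auto simp: level_potential_def d)
    also have "sum ?t {Suc (Suc m)..d} = sum ?c {Suc (Suc m)..d} * (real d / 2 - n)"
      unfolding sum_distrib_right by (intro sum.cong) (auto simp: level_potential_def d)
    finally have "sum ?t {..d} = (n + real d / 2) * (real q + 1 - r)
      - 2 * (real q - (real (Suc m) * (real q - 1) + 1) * r) / (real q - 1)
      + (r / real q) * (real d / 2 - n)"
      using sum_side_degree[OF assms(1), of m d "n + real d / 2"]
        sum_side_degree_upper[OF assms(1), of "Suc m" d]
      by (simp add: d r_def)
    then show ?thesis
      unfolding A_sphere_def B_sphere_def Let_def fl pw of_int_of_nat_eq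
      using assms(1)
      by (simp only:) (intro sphere_constants_identity; simp add: d)
  next
    case False
    then obtain m where d: "d = Suc (m + m)" by (metis oddE mult_2 Suc_eq_plus1)
    have fl: "\<lfloor>real d / 2\<rfloor> = int m" "\<lceil>real d / 2\<rceil> = int (Suc m)"
      by (simp_all add: d floor_eq_iff ceiling_eq_iff field_simps)
    define r where "r = (1 / real q) ^ m"
    have pw: "real q powi (1 - int (Suc m)) = r" "real q powi (- int m) = r"
      using powi[of m] by (simp_all add: r_def)
    have "sum ?t {..d} = sum ?t {..<Suc m} + sum ?t {Suc m..d}"
      by (rule split) (simp add: d)
    also have "sum ?t {..<Suc m} = (\<Sum>i<Suc m. ?c i * ((n + real d / 2) - 2 * real i))"
      by (intro sum.cong) (auto simp: level_potential_def d)
    also have "sum ?t {Suc m..d} = sum ?c {Suc m..d} * (real d / 2 - n)"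
      unfolding sum_distrib_right by (intro sum.cong) (auto simp: level_potential_def d)
    finally have "sum ?t {..d} = (n + real d / 2) * (real q + 1 - r)
      - 2 * (real q - (real (Suc m) * (real q - 1) + 1) * r) / (real q - 1)
      + r * (real d / 2 - n)"
      using sum_side_degree[OF assms(1), of m d "n + real d / 2"]
        sum_side_degree_upper[OF assms(1), of m d]
      by (simp add: d r_def)
    then show ?thesis
      unfolding A_sphere_def B_sphere_def Let_def fl pw of_int_of_nat_eq
      using assms(1)
      by (simp only:) (intro sphere_constants_identity; simp add: d)
  qed
qed

section \<open>The exact distance for large radius and the limit\<close>

context regular_tree_graph
begin

lemma card_gsphere:
  assumes "x \<in> V" "y \<in> V" "1 \<le> D x y" "D x y < n"
  shows "real (card (gsphere G x n)) = real q ^ (n - 1) * (real q + 1)"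
  using sum_gsphere[OF assms, of "\<lambda>_. 1" "\<lambda>_. 1"]
    sum_side_degree_total[OF q_ge_2 assms(3)] by simp

lemma W1_sphere_measure:
  assumes xy: "x \<in> V" "y \<in> V" "1 \<le> D x y" "D x y < n"
  shows "W1 G (sphere_measure G x n) (sphere_measure G y n)
    = A_sphere (D x y) q * real n + B_sphere (D x y) q"
proof -
  have yx: "y \<in> V" "x \<in> V" "1 \<le> D y x" "D y x < n" using xy gdist_sym[of x y] by auto
  define N where "N = real q ^ (n - 1) * (real q + 1)"
  define s where "s = (\<Sum>i\<le>D x y. real (side_degree q (D x y) i) * (1 / real q) ^ i
       * level_potential (D x y) (real n) i)"
  have pos: "real q ^ (n - 1) > 0" using q_ge_2 by simp
  have N: "real (card (gsphere G x n)) = N" "real (card (gsphere G y n)) = N" "N > 0"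
    using card_gsphere[OF xy] card_gsphere[OF yx] pos by (auto simp: N_def)
  have fin: "finite (gsphere G x n)" "finite (gsphere G y n)"
    using finite_gsphere xy yx by blast+
  have ne: "gsphere G x n \<noteq> {}" using N by auto
  have card: "card (gsphere G x n) = card (gsphere G y n)" using N by linarith
  obtain \<phi> where \<phi>: "bij_betw \<phi> (gsphere G x n) (gsphere G y n)"
    "\<And>v. v \<in> gsphere G x n \<Longrightarrow> real (D v (\<phi> v)) = potential x y v - potential x y (\<phi> v)"
    using ex_tight_bijection[OF xy(1,2) fin card] by blast
  have "W1 G (sphere_measure G x n) (sphere_measure G y n)
      = (sum (potential x y) (gsphere G x n) - sum (potential x y) (gsphere G y n))
        / real (card (gsphere G x n))"
    unfolding sphere_measure_def
    by (rule W1_pmf_of_set_eq[OF fin(1) ne \<phi>])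
       (use potential_Lipschitz xy in \<open>auto simp: gsphere_def\<close>)
  also have "sum (potential x y) (gsphere G x n) = real q ^ (n - 1) * s"
    unfolding s_def by (rule sum_potential_gsphere[OF xy])
  \<comment> \<open>Exchanging \<open>x\<close> and \<open>y\<close> negates the potential, so the
    second sum is minus the first.\<close>
  also have "sum (potential x y) (gsphere G y n) = - sum (potential y x) (gsphere G y n)"
    by (simp add: potential_swap[of x y] sum_negf)
  also have "sum (potential y x) (gsphere G y n) = real q ^ (n - 1) * s"
    using sum_potential_gsphere[OF yx] gdist_sym[of y x] by (simp add: s_def)
  also have "(real q ^ (n - 1) * s - - (real q ^ (n - 1) * s)) / real (card (gsphere G x n))
      = 2 * s / (real q + 1)"
  proof -
    have "real q ^ (n - 1) * s - - (real q ^ (n - 1) * s) = real q ^ (n - 1) * (2 * s)" by simp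
    then show ?thesis unfolding N(1) N_def using q_ge_2 by simp
  qed
  also have "\<dots> = A_sphere (D x y) q * real n + B_sphere (D x y) q"
    unfolding s_def by (rule sum_level_potential[OF q_ge_2 xy(3)])
  finally show ?thesis .
qed

end

theorem theorem7p12:
  fixes G :: "'a pair_pre_digraph" and X Y :: 'a and q d :: nat
  assumes "q \<ge> 2" and "d \<ge> 1"
    and "regular_tree (q + 1) G"
    and "X \<in> pverts G" and "Y \<in> pverts G" and "gdist G X Y = d"
  shows "(\<lambda>n. W1 G (sphere_measure G X n) (sphere_measure G Y n)
              - (A_sphere d q * real n + B_sphere d q)) \<longlonglongrightarrow> 0"
proof -
  interpret pair_bidirected_digraph G
    using assms(3) by (simp add: regular_tree_def)
  interpret regular_tree_graph G q
    by unfold_locales (use assms(1,3) in \<open>auto simp: regular_tree_def not_le\<close>)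
  have "W1 G (sphere_measure G X n) (sphere_measure G Y n)
      - (A_sphere d q * real n + B_sphere d q) = 0" if "d < n" for n
    using W1_sphere_measure[of X Y n] assms that by simp
  then have "\<forall>\<^sub>F n in sequentially. W1 G (sphere_measure G X n) (sphere_measure G Y n)
      - (A_sphere d q * real n + B_sphere d q) = 0"
    by (intro eventually_sequentiallyI[of "Suc d"]) simp
  then show ?thesis by (rule tendsto_eventually)
qed

end
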